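(* Let $f(D)=D\,g(D)$ be the delta operator associated both with the logarithmic sequence $p_n^\alpha(x)$ and with the sequence of polynomials $p_n(x)=p_n^{(0)}(x)$. Then for all vectors $\alpha$ of integers with finite support: (1) (Transfer Formula) For all integers $n$, $\ p_n^\alpha(x)=f'(D)\,g(D)^{-n-1}\lambda_n^\alpha(x)$. (2) (Shift Formula) For $n$ neither $0$ nor $-1$, $\ p_n^\alpha(x)=\sigma\,g(D)^{-n}\lambda_{n-1}^\alpha(x)$. (3) (Recurrence Formula) For $n\neq-1$, $\ p_n^\alpha(x)=\sigma\,f'(D)^{-1}p_{n-1}^\alpha(x)$. In particular, for the polynomial sequence $p_n(x)$: (1') (Transfer Formula) $p_n(x)=f'(D)\,g(D)^{-n-1}x^n$ for $n\ge0$. (2') (Shift Formula) $p_n(x)=x\,g(D)^{-n}x^{n-1}$ for $n\ge1$. (3') (Recurrence Formula) $p_n(x)=x\,f'(D)^{-1}p_{n-1}(x)$ for $n\ge1$.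
   Context: Vectors $\alpha=(\alpha_1,\alpha_2,\dots)$ are sequences of integers with only finitely many nonzero entries; $(0)$ is the zero vector. For an integer $n$ put $\ell^{(n),\alpha}=x^n(\log x)^{\alpha_1}(\log\log x)^{\alpha_2}\cdots$, regarded as linearly independent formal monomials. The derivative acts termwise on (possibly infinite) formal sums by $$D\ell^{(n),\alpha}=n\,\ell^{(n-1),\alpha}+\sum_{k\ge1}\alpha_k\,\ell^{(n-1),(\alpha_1-1,\dots,\alpha_k-1,\alpha_{k+1},\alpha_{k+2},\dots)}.$$ Roman factorial: $\lfloor n\rceil!=n!$ for $n\ge0$ and $\lfloor n\rceil!=(-1)^{n-1}/(-n-1)!$ for $n<0$; $\lfloor n\rceil=n$ for $n\neq0$ and $\lfloor 0\rceil=1$. The harmonic logarithm of degree $n$ and order $\alpha$ is the formal series $$\lambda_n^\alpha(x)=\sum_{\rho}\lfloor n\rceil!\,s(-n,\rho_1)\Bigl[\prod_{i\ge1}e_{\rho_i-\rho_{i+1}}(\alpha_i,\alpha_i-1,\dots,\alpha_i-\rho_i+1)\Bigr]\ell^{(n),\alpha-\rho},$$ over all weakly decreasing sequences $\rho=(\rho_1,\rho_2,\dots)$ of nonnegative integers with finitely many nonzero terms. Here $s(m,k)$ ($m\in\mathbb Z$, $k\ge0$) is the coefficient of $y^k$ in the Taylor expansion at $0$ of $\Gamma(y+1)/\Gamma(y-m+1)$, and $e_k$ is the $k$-th elementary symmetric function of the listed arguments. In particular $\lambda_n^{(0)}=x^n$ for $n\ge0$ and $\lambda_n^{(0)}=0$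 for $n<0$. $\mathcal L^\alpha$ is the complex vector space of all formal series $\sum_{n\le N}c_n\lambda_n^\alpha(x)$, $N\in\mathbb Z$, $c_n\in\mathbb C$. One has $D\lambda_n^\alpha=\lfloor n\rceil\lambda_{n-1}^\alpha$; formal power series in $D$ act termwise on each $\mathcal L^\alpha$. A delta operator is $f(D)=\sum_{k\ge1}a_kD^k$ with $a_k\in\mathbb C$, $a_1\ne0$; then $g(D)=f(D)/D$ and $f'(D)=\sum_{k\ge1}ka_kD^{k-1}$ are invertible formal power series in $D$. The Roman shift $\sigma$ is the linear operator defined termwise by $\sigma\lambda_n^\alpha=\lambda_{n+1}^\alpha$ for $n\ne-1$ and $\sigma\lambda_{-1}^\alpha=0$. The augmentation $\langle\ \rangle_\alpha$ is the linear functional giving the coefficient of $\lambda_0^\alpha$. A logarithmic sequence is a family $p_n^\alpha(x)$ ($n\in\mathbb Z$, $\alpha$ a vector) with $p_n^\alpha=\sum_{k\le n}c_k\lambda_k^\alpha$, $c_n\ne0$ (for $\alpha=(0)$: polynomials of degree $n$ for $n\ge0$, and $0$ for $n<0$). The logarithmic sequence associated with $f(D)$ is the unique one satisfying $\langle p_n^\alpha\rangle_\alpha=\delta_{n0}$ and $f(D)p_n^\alpha=\lfloor n\rceil p_{n-1}^\alpha$ for all $n,\alpha$.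
   Formalization: The Recurrence Formula (3) is stated for n ≠ 0 (including n = -1) instead of n ≠ -1, because at n = 0 it always fails: σ never yields a λ_0 term, while p_0^α has λ_0-coefficient 1 (e.g. f = D, α = (0): p_0 = 1, p_{-1} = 0). *)

theory Defs
  imports "HOL-Complex_Analysis.Complex_Analysis" "HOL-Library.Poly_Mapping"
begin

text \<open>
  The vector \<open>(\<alpha>\<^sub>1, \<alpha>\<^sub>2, \<dots>)\<close> is a \<open>nat \<Rightarrow>\<^sub>0 int\<close> indexed from 0: \<open>\<alpha>\<^sub>i\<^sub>+\<^sub>1\<close> is \<open>Poly_Mapping.lookup \<alpha> i\<close>.
  A formal (possibly infinite) sum of monomials is its family of coefficients: \<open>u n \<alpha>\<close> is the
  coefficient of \<open>x ^ n (log x) ^ \<alpha>\<^sub>1 (log log x) ^ \<alpha>\<^sub>2 \<dots>\<close>.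
\<close>

type_synonym expo = "nat \<Rightarrow>\<^sub>0 int"
type_synonym log_series = "int \<Rightarrow> expo \<Rightarrow> complex"

definition ell :: "int \<Rightarrow> expo \<Rightarrow> log_series" where
  "ell n \<alpha> = (\<lambda>m \<beta>. if m = n \<and> \<beta> = \<alpha> then 1 else 0)"

definition ls_add :: "log_series \<Rightarrow> log_series \<Rightarrow> log_series" where
  "ls_add u v = (\<lambda>m \<beta>. u m \<beta> + v m \<beta>)"

definition ls_scale :: "complex \<Rightarrow> log_series \<Rightarrow> log_series" where
  "ls_scale c u = (\<lambda>m \<beta>. c * u m \<beta>)"

text \<open>
  Formal summation: meaningful when each coefficient receives only finitely many nonzero
  contributions, which holds for every use below on the spaces \<open>log_space \<alpha>\<close>
  (\<^const>\<open>Sum_any\<close> is 0 otherwise).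
\<close>

definition ls_sum :: "('i \<Rightarrow> log_series) \<Rightarrow> log_series" where
  "ls_sum F = (\<lambda>m \<beta>. Sum_any (\<lambda>i. F i m \<beta>))"

definition roman :: "int \<Rightarrow> complex" where
  "roman n = (if n = 0 then 1 else of_int n)"

definition roman_fact :: "int \<Rightarrow> complex" where
  "roman_fact n = (if n \<ge> 0 then fact (nat n) else (-1) powi (n - 1) / fact (nat (- n - 1)))"

text \<open>
  At the poles of \<open>Gamma (y - m + 1)\<close> the quotient has a removable singularity with value 0.
  HOL's conventions (\<open>Gamma\<close> is 0 at its poles, and \<open>z / 0 = 0\<close>) give exactly this value, so the
  function below is analytic at 0 for every \<open>m\<close>.
\<close>

definition stirling_int :: "int \<Rightarrow> nat \<Rightarrow> complex" where
  "stirling_int m k =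
     fps_nth (fps_expansion (\<lambda>y. Gamma (y + 1) / Gamma (y - of_int m + 1)) 0) k"

definition elem_sym :: "nat \<Rightarrow> nat \<Rightarrow> (nat \<Rightarrow> complex) \<Rightarrow> complex" where
  "elem_sym k r z = (\<Sum>A | A \<subseteq> {..<r} \<and> card A = k. \<Prod>j\<in>A. z j)"

text \<open>
  The sum over the sequences \<open>\<rho>\<close> is a formal sum; the product over all indices is a
  \<^const>\<open>Prod_any\<close>, since its factors beyond the support of \<open>\<rho>\<close> are \<open>e\<^sub>0() = 1\<close>.
\<close>

definition harmonic_log :: "int \<Rightarrow> expo \<Rightarrow> log_series" where
  "harmonic_log n \<alpha> = ls_sum (\<lambda>\<rho> :: nat \<Rightarrow>\<^sub>0 nat.
     if antimono (Poly_Mapping.lookup \<rho>) then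
       ls_scale
         (roman_fact n * stirling_int (- n) (Poly_Mapping.lookup \<rho> 0) *
          Prod_any (\<lambda>i. elem_sym (Poly_Mapping.lookup \<rho> i - Poly_Mapping.lookup \<rho> (Suc i)) (Poly_Mapping.lookup \<rho> i)
                          (\<lambda>j. of_int (Poly_Mapping.lookup \<alpha> i - int j))))
         (ell n (\<alpha> - Poly_Mapping.map int \<rho>))
     else (\<lambda>_ _. 0))"

definition D_ell :: "int \<Rightarrow> expo \<Rightarrow> log_series" where
  "D_ell n \<alpha> =
     ls_add (ls_scale (of_int n) (ell (n - 1) \<alpha>))
       (ls_sum (\<lambda>k. ls_scale (of_int (Poly_Mapping.lookup \<alpha> k))
          (ell (n - 1) (\<alpha> - (\<Sum>i\<le>k. Poly_Mapping.single i 1)))))"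

definition D :: "log_series \<Rightarrow> log_series" where
  "D u = ls_sum (\<lambda>(n, \<alpha>). ls_scale (u n \<alpha>) (D_ell n \<alpha>))"

definition fps_op :: "complex fps \<Rightarrow> log_series \<Rightarrow> log_series" where
  "fps_op h u = ls_sum (\<lambda>k. ls_scale (fps_nth h k) ((D ^^ k) u))"

definition x_mult :: "log_series \<Rightarrow> log_series" where
  "x_mult u = (\<lambda>n \<alpha>. u (n - 1) \<alpha>)"

definition log_comb :: "expo \<Rightarrow> (int \<Rightarrow> complex) \<Rightarrow> log_series" where
  "log_comb \<alpha> c = ls_sum (\<lambda>n. ls_scale (c n) (harmonic_log n \<alpha>))"

definition bdd_degree :: "(int \<Rightarrow> complex) \<Rightarrow> bool" where
  "bdd_degree c \<longleftrightarrow> (\<exists>N. \<forall>n>N. c n = 0)"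

definition log_space :: "expo \<Rightarrow> log_series set" where
  "log_space \<alpha> = {log_comb \<alpha> c | c. bdd_degree c}"

text \<open>
  The two operators below are determined by the coefficients \<open>c\<close> of an element of \<open>log_space \<alpha>\<close>.
  For \<open>\<alpha> \<noteq> 0\<close> these are unique. For \<open>\<alpha> = 0\<close> only the \<open>c n\<close> with \<open>n \<ge> 0\<close> are (the harmonic
  logarithms of negative degree vanish), but the results do not depend on the others.
\<close>

definition augmentation :: "expo \<Rightarrow> log_series \<Rightarrow> complex" where
  "augmentation \<alpha> u = (THE z. \<exists>c. bdd_degree c \<and> u = log_comb \<alpha> c \<and> z = c 0)"

definition roman_shift :: "expo \<Rightarrow> log_series \<Rightarrow> log_series" where
  "roman_shift \<alpha> u = (THE v. \<exists>c. bdd_degree c \<and> u = log_comb \<alpha> c \<and>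
     v = ls_sum (\<lambda>n. ls_scale (c n) (if n = -1 then (\<lambda>_ _. 0) else harmonic_log (n + 1) \<alpha>)))"

definition delta_series :: "complex fps \<Rightarrow> bool" where
  "delta_series f \<longleftrightarrow> fps_nth f 0 = 0 \<and> fps_nth f 1 \<noteq> 0"

text \<open>
  For \<open>\<alpha> = 0\<close> the condition below says that \<open>p n 0\<close> is a polynomial of degree \<open>n\<close> if \<open>n \<ge> 0\<close>,
  and that it is 0 if \<open>n < 0\<close>.
\<close>

definition log_sequence :: "(int \<Rightarrow> expo \<Rightarrow> log_series) \<Rightarrow> bool" where
  "log_sequence p \<longleftrightarrow>
     (\<forall>n \<alpha>. \<exists>c. (\<forall>k>n. c k = 0) \<and> c n \<noteq> 0 \<and> p n \<alpha> = log_comb \<alpha> c)"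

definition associated :: "complex fps \<Rightarrow> (int \<Rightarrow> expo \<Rightarrow> log_series) \<Rightarrow> bool" where
  "associated f p \<longleftrightarrow> log_sequence p \<and>
     (\<forall>n \<alpha>. augmentation \<alpha> (p n \<alpha>) = (if n = 0 then 1 else 0)) \<and>
     (\<forall>n \<alpha>. fps_op f (p n \<alpha>) = ls_scale (roman n) (p (n - 1) \<alpha>))"

end

theory Submission
  imports Defs
begin

text \<open>
  Expanding in \<open>\<lambda>\<^sub>n / \<lfloor>n\<rceil>!\<close> turns the space of order \<open>\<alpha>\<close> into the field of Laurent series in \<open>X\<close>, where
  \<open>\<lambda>\<^sub>n\<close> is \<open>\<lfloor>n\<rceil>! X\<^sup>-\<^sup>n\<close>, the derivative is multiplication by \<open>X\<close>, the augmentation is the coefficient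
  of \<open>X\<^sup>0\<close>, and the Roman shift is \<open>F \<mapsto> - X (X\<^sup>-\<^sup>1 F)'\<close>; for \<open>\<alpha> = 0\<close> one works modulo \<open>X \<complex>[[X]]\<close>.
  The transfer formula then asserts that \<open>p\<^sub>n\<close> is \<open>\<lfloor>n\<rceil>! X f' f\<^sup>-\<^sup>n\<^sup>-\<^sup>1\<close>. For \<open>n \<noteq> 0\<close> this is
  \<open>- \<lfloor>n-1\<rceil>! X (f\<^sup>-\<^sup>n)'\<close>, which has no coefficient at \<open>X\<^sup>0\<close>, since a derivative has no residue, and
  which is the shift of \<open>\<lfloor>n-1\<rceil>! X f\<^sup>-\<^sup>n\<close>; this yields the other two formulas. Uniqueness holds
  because multiplication by \<open>f\<close> raises the order by exactly one.
  That \<open>D \<lambda>\<^sub>n = \<lfloor>n\<rceil> \<lambda>\<^sub>n\<^sub>-\<^sub>1\<close> follows from the recurrence of the Stirling numbers and a telescoping sum of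
  products of elementary symmetric functions.
\<close>

notation fls_nth (infixl \<open>$$\<close> 75)

abbreviation "lk \<equiv> Poly_Mapping.lookup"

section \<open>Formal sums with at most one nonzero term\<close>

lemma Sum_any_single:
  assumes "\<And>i. i \<noteq> a \<Longrightarrow> F i = 0"
  shows "Sum_any F = F a"
proof -
  have "Sum_any F = sum F {a}"
    by (rule Sum_any.expand_superset) (use assms in auto)
  then show ?thesis by simp
qed

lemma Sum_any_zero:
  assumes "\<And>i. F i = 0"
  shows "Sum_any F = 0"
  using assms by simp

subsection \<open>Elementary symmetric functions\<close>

lemma elem_sym_0 [simp]: "elem_sym 0 r z = 1"
proof -
  have *: "A = {}" if "A \<subseteq> {..<r}" "card A = 0" for A
    using finite_subset[OF that(1)] that(2) by simp
  have "{A. A \<subseteq> {..<r} \<and> card A = 0} = {{}}"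
    by (intro subset_antisym subsetI) (use * in simp_all)
  then show ?thesis unfolding elem_sym_def by (simp only:, simp)
qed

lemma elem_sym_gt:
  assumes "r < k"
  shows "elem_sym k r z = 0"
proof -
  have "card A \<noteq> k" if "A \<subseteq> {..<r}" for A
    using card_mono[OF finite_lessThan that] assms by simp
  then have "{A. A \<subseteq> {..<r} \<and> card A = k} = {}"
    by blast
  then show ?thesis unfolding elem_sym_def by (simp only: sum.empty)
qed

text \<open>Sort the subsets of \<open>{..<Suc r}\<close> by whether they contain the last index
  \<open>r\<close>.\<close>

lemma elem_sym_Suc:
  "elem_sym (Suc k) (Suc r) z = elem_sym (Suc k) r z + z r * elem_sym k r z"
proof -
  let ?P = "\<lambda>k r. {A. A \<subseteq> {..<r} \<and> card A = k}"
  have fin: "finite A" if "A \<subseteq> {..<r}" for A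
    using that finite_subset[OF _ finite_lessThan] by blast
  have finP: "finite (?P k r)" for k and r :: nat
    by (rule finite_subset[of _ "Pow {..<r}"]) auto
  have inj: "inj_on (insert r) (?P k r)"
  proof (rule inj_onI)
    fix A B assume AB: "A \<in> ?P k r" "B \<in> ?P k r" and eq: "insert r A = insert r B"
    have "r \<notin> A" "r \<notin> B" using AB by auto
    then show "A = B" using eq by (metis Diff_insert_absorb)
  qed
  have split: "?P (Suc k) (Suc r) = ?P (Suc k) r \<union> insert r ` ?P k r"
  proof (intro set_eqI iffI)
    fix A assume A: "A \<in> ?P (Suc k) (Suc r)"
    show "A \<in> ?P (Suc k) r \<union> insert r ` ?P k r"
    proof (cases "r \<in> A")
      case True
      have "A = insert r (A - {r})" using True by blast
      moreover have "A - {r} \<in> ?P k r"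
        using A True by (auto simp: lessThan_Suc)
      ultimately show ?thesis by blast
    next
      case False
      then show ?thesis using A by (auto simp: lessThan_Suc)
    qed
  next
    fix A assume "A \<in> ?P (Suc k) r \<union> insert r ` ?P k r"
    then show "A \<in> ?P (Suc k) (Suc r)"
    proof
      assume "A \<in> insert r ` ?P k r"
      then obtain B where B: "B \<subseteq> {..<r}" "card B = k" "A = insert r B" by blast
      then have "r \<notin> B" by auto
      with B fin show ?thesis by (auto simp: lessThan_Suc)
    qed (auto simp: lessThan_Suc)
  qed
  have disj: "?P (Suc k) r \<inter> insert r ` ?P k r = {}" by auto
  have "elem_sym (Suc k) (Suc r) z =
      elem_sym (Suc k) r z + (\<Sum>A\<in>insert r ` ?P k r. \<Prod>j\<in>A. z j)"
    unfolding elem_sym_def split using finP disj by (subst sum.union_disjoint) auto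
  also have "(\<Sum>A\<in>insert r ` ?P k r. \<Prod>j\<in>A. z j) = (\<Sum>A\<in>?P k r. \<Prod>j\<in>insert r A. z j)"
    by (subst sum.reindex[OF inj]) simp
  also have "\<dots> = (\<Sum>A\<in>?P k r. z r * (\<Prod>j\<in>A. z j))"
    by (intro sum.cong refl prod.insert) (use fin in auto)
  also have "\<dots> = z r * elem_sym k r z"
    by (simp add: elem_sym_def sum_distrib_left)
  finally show ?thesis .
qed

lemma elem_sym_all: "elem_sym k k z = (\<Prod>j<k. z j)"
  by (induction k) (simp_all add: elem_sym_Suc elem_sym_gt mult.commute)

subsection \<open>The weight of a partition\<close>

definition log_factor :: "expo \<Rightarrow> (nat \<Rightarrow> nat) \<Rightarrow> nat \<Rightarrow> complex" where
  "log_factor \<alpha> r i = elem_sym (r i - r (Suc i)) (r i) (\<lambda>j. of_int (lk \<alpha> i - int j))"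

text \<open>The value 0 off the weakly decreasing sequences makes the weight usable for
  \<open>\<rho> - ones k\<close>, which need not be decreasing.\<close>

definition log_weight :: "expo \<Rightarrow> (nat \<Rightarrow>\<^sub>0 nat) \<Rightarrow> complex" where
  "log_weight \<alpha> \<rho> = (if antimono (lk \<rho>) then Prod_any (log_factor \<alpha> (lk \<rho>)) else 0)"

lemma lookup_map_int [simp]: "lk (Poly_Mapping.map int \<rho>) i = int (lk \<rho> i)"
  by (simp add: Poly_Mapping.map.rep_eq when_def)

lemma map_int_eq_iff [simp]: "Poly_Mapping.map int \<rho> = Poly_Mapping.map int \<rho>' \<longleftrightarrow> \<rho> = \<rho>'"
  by (simp add: poly_mapping_eq_iff fun_eq_iff)

lemma antimono_Suc_iff: "antimono (r :: nat \<Rightarrow> nat) \<longleftrightarrow> (\<forall>i. r (Suc i) \<le> r i)"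
proof
  assume *: "\<forall>i. r (Suc i) \<le> r i"
  show "antimono r" by (rule antimonoI, rule lift_Suc_antimono_le) (use * in auto)
qed (simp add: antimonoD)

lemma lookup_eventually_zero:
  obtains N where "\<And>i. i \<ge> N \<Longrightarrow> lk (u :: nat \<Rightarrow>\<^sub>0 'a::zero) i = 0"
proof -
  have "finite (Poly_Mapping.keys u)" by simp
  then obtain N where "\<forall>i\<in>Poly_Mapping.keys u. i < N"
    using finite_nat_set_iff_bounded by blast
  then show ?thesis
    by (intro that[of N]) (metis in_keys_iff not_le)
qed

lemma log_weight_eq_prod:
  assumes "antimono (lk \<rho>)" "\<And>i. i \<ge> N \<Longrightarrow> lk \<rho> i = 0"
  shows "log_weight \<alpha> \<rho> = (\<Prod>i<N. log_factor \<alpha> (lk \<rho>) i)"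
proof -
  have "log_factor \<alpha> (lk \<rho>) i = 1" if "i \<ge> N" for i
    using assms(2)[of i] that by (simp add: log_factor_def)
  then have "{i. log_factor \<alpha> (lk \<rho>) i \<noteq> 1} \<subseteq> {..<N}"
    by (metis (mono_tags, lifting) lessThan_iff linorder_not_le mem_Collect_eq subsetI)
  then show ?thesis
    using assms(1) by (simp add: log_weight_def Prod_any.expand_superset[of "{..<N}"])
qed

lemma partition_length:
  fixes r :: "nat \<Rightarrow>\<^sub>0 nat"
  assumes "antimono (lk r)"
  obtains K where "\<And>i. lk r i > 0 \<longleftrightarrow> i < K"
proof -
  obtain N where N: "\<And>i. i \<ge> N \<Longrightarrow> lk r i = 0" using lookup_eventually_zero by blast
  define K where "K = (LEAST k. lk r k = 0)"
  have K0: "lk r K = 0" unfolding K_def by (rule LeastI[of _ N]) (simp add: N)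
  show ?thesis
  proof (rule that[of K])
    fix i show "lk r i > 0 \<longleftrightarrow> i < K"
    proof
      assume "lk r i > 0"
      then show "i < K" using antimonoD[OF assms, of K i] K0 by (cases "i < K") auto
    next
      assume "i < K"
      then show "lk r i > 0" unfolding K_def using not_less_Least by blast
    qed
  qed
qed

text \<open>The vector that differentiating the logarithm of index \<open>k\<close> subtracts from
  an exponent. The entry type stays open because the vector is added to integer exponents and
  subtracted from partitions.\<close>

definition ones :: "nat \<Rightarrow> nat \<Rightarrow>\<^sub>0 'a::semiring_1" where
  "ones k = (\<Sum>i\<le>k. Poly_Mapping.single i 1)"

lemma lookup_ones [simp]: "lk (ones k) i = (if i \<le> k then 1 else 0)"
proof -
  have "lk (ones k :: nat \<Rightarrow>\<^sub>0 'a) i = (\<Sum>j\<le>k. if j = i then 1 else 0)"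
    by (simp add: ones_def lookup_sum lookup_single when_def)
  also have "\<dots> = (if i \<le> k then 1 else 0)"
    by simp
  finally show ?thesis .
qed

lemma ones_eq_iff [simp]:
  "(ones k :: nat \<Rightarrow>\<^sub>0 'a::semiring_1) = ones l \<longleftrightarrow> k = l"
proof
  assume "(ones k :: nat \<Rightarrow>\<^sub>0 'a) = ones l"
  then have "lk (ones k :: nat \<Rightarrow>\<^sub>0 'a) i = lk (ones l) i" for i by simp
  from this[of k] this[of l] show "k = l" by (simp split: if_splits)
qed simp

lemma ones_neq_0 [simp]: "(ones k :: nat \<Rightarrow>\<^sub>0 'a::semiring_1) \<noteq> 0"
proof
  assume "(ones k :: nat \<Rightarrow>\<^sub>0 'a) = 0"
  then have "lk (ones k :: nat \<Rightarrow>\<^sub>0 'a) 0 = 0" by simp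
  then show False by simp
qed

text \<open>
  Lowering the arguments of the first \<open>k\<close> factors by one gives products \<open>T k\<close>, and the recurrence
  for elementary symmetric functions makes each summand below equal to \<open>T k - T (Suc k)\<close>.
  The last product \<open>T K\<close> vanishes since it contains \<open>e\<^sub>m\<close> of \<open>m - 1\<close> arguments.
\<close>

lemma log_weight_telescope:
  assumes anti: "antimono (lk \<rho>)" and K: "\<And>i. lk \<rho> i > 0 \<longleftrightarrow> i < K" and "K > 0"
  shows "(\<Sum>k<K. of_int (lk \<alpha> k - int (lk \<rho> k) + 1) * log_weight \<alpha> (\<rho> - ones k)) = log_weight \<alpha> \<rho>"
proof -
  define r where "r = lk \<rho>"
  define z where "z = (\<lambda>i j. of_int (lk \<alpha> i - int j) :: complex)"
  define e where "e = (\<lambda>i m. elem_sym (r i - r (Suc i)) m (z i))"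
  define T where "T = (\<lambda>k. (\<Prod>i<k. e i (r i - 1)) * (\<Prod>i\<in>{k..<K}. e i (r i)))"
  have Suc_le: "r (Suc i) \<le> r i" for i
    using anti unfolding antimono_Suc_iff r_def by simp
  have pos: "r i > 0" if "i < K" for i using K that by (simp add: r_def)
  have zero: "r i = 0" if "i \<ge> K" for i using K[of i] that by (simp add: r_def)
  have step: "of_int (lk \<alpha> k - int (r k) + 1) * log_weight \<alpha> (\<rho> - ones k) = T k - T (Suc k)"
    if "k < K" for k
  proof -
    define A where "A = (\<Prod>i<k. e i (r i - 1))"
    define B where "B = (\<Prod>i\<in>{Suc k..<K}. e i (r i))"
    obtain m where m: "r k = Suc m" using pos[OF \<open>k < K\<close>] gr0_implies_Suc by blast
    have T1: "T k = A * (e k (Suc m) * B)"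
      using that m by (simp add: T_def A_def B_def prod.atLeast_Suc_lessThan)
    have T2: "T (Suc k) = A * e k m * B"
      using m by (simp add: T_def A_def B_def)
    have lkr: "lk (\<rho> - ones k) i = (if i \<le> k then r i - 1 else r i)" for i
      by (simp add: lookup_minus r_def)
    show ?thesis
    proof (cases "r (Suc k) = r k")
      \<comment> \<open>Lowering part \<open>k\<close> below the equal part \<open>Suc k\<close>
        destroys monotonicity, so the weight is 0. Factor \<open>k\<close> is e_0 = 1 for any number
        of arguments, so \<open>T k = T (Suc k)\<close>.\<close>
      case True
      have "lk (\<rho> - ones k) (Suc k) > lk (\<rho> - ones k) k"
        using m True by (simp add: lkr)
      then have "\<not> antimono (lk (\<rho> - ones k))"
        unfolding antimono_Suc_iff using not_le by blast
      then have "log_weight \<alpha> (\<rho> - ones k) = 0" by (simp add: log_weight_def)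
      moreover have "e k l = 1" for l using True by (simp add: e_def)
      ultimately show ?thesis by (simp add: T1 T2)
    next
      case False
      obtain d where d: "r k - r (Suc k) = Suc d"
        using False Suc_le[of k] by (metis Suc_diff_Suc le_neq_implies_less)
      have "antimono (lk (\<rho> - ones k))"
        unfolding antimono_Suc_iff lkr
      proof
        fix i show "(if Suc i \<le> k then r (Suc i) - 1 else r (Suc i)) \<le> (if i \<le> k then r i - 1 else r i)"
          using Suc_le[of i] False by (cases "i = k") auto
      qed
      moreover have "lk (\<rho> - ones k) i = 0" if "i \<ge> K" for i
        using zero[OF that] by (simp add: lkr)
      ultimately have "log_weight \<alpha> (\<rho> - ones k) = (\<Prod>i<K. log_factor \<alpha> (lk (\<rho> - ones k)) i)"
        by (rule log_weight_eq_prod)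
      also have "{..<K} = {..<k} \<union> insert k {Suc k..<K}" using that by auto
      also have "(\<Prod>i\<in>{..<k} \<union> insert k {Suc k..<K}. log_factor \<alpha> (lk (\<rho> - ones k)) i) =
          (\<Prod>i<k. log_factor \<alpha> (lk (\<rho> - ones k)) i) * (log_factor \<alpha> (lk (\<rho> - ones k)) k *
          (\<Prod>i\<in>{Suc k..<K}. log_factor \<alpha> (lk (\<rho> - ones k)) i))"
        by (subst prod.union_disjoint) auto
      \<comment> \<open>For \<open>i < k\<close> both neighbouring parts drop by one,
        \<open>r (Suc i)\<close> being positive, so the degree of the factor stays and only its last
        argument disappears.\<close>
      also have "(\<Prod>i<k. log_factor \<alpha> (lk (\<rho> - ones k)) i) = A"
        unfolding A_def
      proof (intro prod.cong refl)
        fix i assume i: "i \<in> {..<k}"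
        then have "r (Suc i) > 0" using that by (intro pos) simp
        then have "r i - 1 - (r (Suc i) - 1) = r i - r (Suc i)" by simp
        then show "log_factor \<alpha> (lk (\<rho> - ones k)) i = e i (r i - 1)"
          using i by (simp add: log_factor_def lkr e_def z_def)
      qed
      also have "(\<Prod>i\<in>{Suc k..<K}. log_factor \<alpha> (lk (\<rho> - ones k)) i) = B"
        unfolding B_def by (intro prod.cong refl) (simp add: log_factor_def lkr e_def z_def)
      \<comment> \<open>At index \<open>k\<close> only the part itself drops, so the degree falls
        from \<open>Suc d\<close> to \<open>d\<close> and the number of arguments from
        \<open>Suc m\<close> to \<open>m\<close>.\<close>
      also have "log_factor \<alpha> (lk (\<rho> - ones k)) k = elem_sym d m (z k)"
      proof -
        have "m - r (Suc k) = d" using d m by simp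
        then show ?thesis using m by (simp add: log_factor_def lkr z_def)
      qed
      finally have W: "log_weight \<alpha> (\<rho> - ones k) = A * (elem_sym d m (z k) * B)" .
      have "e k (Suc m) = e k m + z k m * elem_sym d m (z k)"
        unfolding e_def d by (rule elem_sym_Suc)
      moreover have "of_int (lk \<alpha> k - int (r k) + 1) = z k m" by (simp add: z_def m)
      ultimately show ?thesis by (simp add: T1 T2 W algebra_simps)
    qed
  qed
  have "(\<Sum>k<K. of_int (lk \<alpha> k - int (lk \<rho> k) + 1) * log_weight \<alpha> (\<rho> - ones k)) =
      (\<Sum>k<K. T k - T (Suc k))"
    by (intro sum.cong refl) (use step in \<open>simp add: r_def\<close>)
  also have "\<dots> = T 0 - T K"
    by (induction K) auto
  also have "T K = 0"
  proof -
    have "e (K - 1) (r (K - 1) - 1) = 0"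
      using pos[of "K - 1"] zero[of K] \<open>K > 0\<close> by (simp add: e_def elem_sym_gt)
    then show ?thesis using \<open>K > 0\<close> by (auto simp: T_def intro!: bexI[of _ "K - 1"])
  qed
  also have "T 0 = log_weight \<alpha> \<rho>"
    using log_weight_eq_prod[OF anti, of K \<alpha>] zero
    by (simp add: T_def e_def r_def log_factor_def z_def atLeast0LessThan)
  finally show ?thesis by simp
qed

lemma log_weight_0 [simp]: "log_weight \<alpha> 0 = 1"
  by (subst log_weight_eq_prod[of _ 0]) (auto intro: antimonoI)

text \<open>In the last factor with a nonzero part, the degree equals the number of arguments, so
  the factor is a product containing the argument 0. Hence only \<rho> = 0 contributes at order
  0.\<close>

lemma log_weight_zero_exponent:
  assumes "\<rho> \<noteq> 0"
  shows "log_weight 0 \<rho> = 0"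
proof (cases "antimono (lk \<rho>)")
  case True
  obtain K where K: "\<And>i. lk \<rho> i > 0 \<longleftrightarrow> i < K" using partition_length[OF True] by blast
  have "K > 0"
  proof (rule ccontr)
    assume "\<not> K > 0"
    then have "\<rho> = 0" using K by (intro poly_mapping_eqI) auto
    with assms show False by simp
  qed
  define k where "k = K - 1"
  have "lk \<rho> k > 0" "lk \<rho> (Suc k) = 0" using K[of k] K[of "Suc k"] \<open>K > 0\<close> by (auto simp: k_def)
  then have "log_factor 0 (lk \<rho>) k = 0"
    by (auto simp: log_factor_def elem_sym_all intro!: bexI[of _ 0])
  then have "(\<Prod>i<K. log_factor 0 (lk \<rho>) i) = 0"
    using \<open>K > 0\<close> by (auto simp: k_def intro!: bexI[of _ "K - 1"])
  then show ?thesis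
    using log_weight_eq_prod[OF True, of K 0] K by (metis gr0I not_le)
qed (simp add: log_weight_def)

text \<open>The factors before \<open>k\<close> are e_0, and the last one is e_1 of the single
  argument \<open>lk \<alpha> k\<close>.\<close>

lemma log_weight_ones_neq_0:
  assumes "lk \<alpha> k \<noteq> 0"
  shows "log_weight \<alpha> (ones k) \<noteq> 0"
proof -
  have "antimono (lk (ones k :: nat \<Rightarrow>\<^sub>0 nat))" by (auto simp: antimono_Suc_iff)
  then have "log_weight \<alpha> (ones k) = (\<Prod>i<Suc k. log_factor \<alpha> (lk (ones k)) i)"
    by (rule log_weight_eq_prod) auto
  also have "\<dots> = (\<Prod>i<Suc k. if i = k then of_int (lk \<alpha> k) else 1)"
    by (intro prod.cong refl) (auto simp: log_factor_def elem_sym_all)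
  also have "\<dots> = of_int (lk \<alpha> k)" by simp
  finally show ?thesis using assms by simp
qed

subsection \<open>The Stirling numbers\<close>

text \<open>The half-plane \<open>Re y > -1\<close> contains 0 and no pole of
  \<open>Gamma (y + 1)\<close>. Since \<open>rGamma\<close> is entire, the quotient written with
  \<open>rGamma\<close> is holomorphic there.\<close>

lemma fps_expansion_Gamma_quotient:
  "(\<lambda>y::complex. Gamma (y + 1) / Gamma (y - of_int m + 1)) has_fps_expansion
     fps_expansion (\<lambda>y. Gamma (y + 1) / Gamma (y - of_int m + 1)) 0"
proof (rule has_fps_expansion_fps_expansion)
  show "open {y::complex. Re y > -1}" by (rule open_halfspace_Re_gt)
  have *: "y + 1 \<notin> \<int>\<^sub>\<le>\<^sub>0" if "Re y > -1" for y :: complex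
  proof
    assume "y + 1 \<in> \<int>\<^sub>\<le>\<^sub>0"
    then obtain n where "y + 1 = of_int n" "n \<le> 0" by (elim nonpos_Ints_cases)
    then have "Re (y + 1) \<le> 0" by simp
    with that show False by simp
  qed
  show "(\<lambda>y::complex. Gamma (y + 1) / Gamma (y - of_int m + 1)) holomorphic_on {y. Re y > -1}"
    unfolding divide_inverse rGamma_inverse_Gamma[symmetric]
    by (intro holomorphic_intros) (use * in auto)
qed auto

lemma has_fps_expansion_stirling:
  "(\<lambda>y. Gamma (y + 1) / Gamma (y - of_int m + 1)) has_fps_expansion Abs_fps (stirling_int m)"
proof -
  have "Abs_fps (stirling_int m) = fps_expansion (\<lambda>y. Gamma (y + 1) / Gamma (y - of_int m + 1)) 0"
    by (rule fps_ext) (simp add: stirling_int_def)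
  then show ?thesis using fps_expansion_Gamma_quotient[of m] by simp
qed

text \<open>By the functional equation of \<open>rGamma\<close>, passing from \<open>- n\<close> to
  \<open>1 - n\<close> multiplies the generating function by y + n; compare coefficients of
  y^k.\<close>

lemma stirling_int_rec:
  "stirling_int (1 - n) k =
     of_int n * stirling_int (- n) k + (if k = 0 then 0 else stirling_int (- n) (k - 1))"
proof -
  define F where "F = (\<lambda>m (y :: complex). Gamma (y + 1) / Gamma (y - of_int m + 1))"
  have rec: "F (1 - n) y = (of_int n + y) * F (- n) y" for y
    using rGamma_plus1[of "y + of_int n"]
    by (simp add: F_def divide_inverse rGamma_inverse_Gamma[symmetric] add_ac)
  have "(\<lambda>y. (of_int n + y) * F (- n) y) has_fps_expansion
      (fps_const (of_int n) + fps_X) * Abs_fps (stirling_int (- n))"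
    unfolding F_def by (intro fps_expansion_intros has_fps_expansion_stirling)
  moreover have "(\<lambda>y. (of_int n + y) * F (- n) y) has_fps_expansion Abs_fps (stirling_int (1 - n))"
    unfolding rec[symmetric] unfolding F_def by (rule has_fps_expansion_stirling)
  ultimately have "Abs_fps (stirling_int (1 - n)) =
      (fps_const (of_int n) + fps_X) * Abs_fps (stirling_int (- n))"
    using fps_expansion_unique_complex by blast
  then have "fps_nth (Abs_fps (stirling_int (1 - n))) k =
      fps_nth ((fps_const (of_int n) + fps_X) * Abs_fps (stirling_int (- n))) k"
    by simp
  then show ?thesis by (simp add: distrib_right)
qed

lemma stirling_int_0: "stirling_int m 0 = rGamma (1 - of_int m)"
  using has_fps_expansion_imp_0_eq_fps_nth_0[OF has_fps_expansion_stirling[of m]]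
  by (simp add: divide_inverse rGamma_inverse_Gamma)

lemma stirling_int_pos_0:
  assumes "m > 0"
  shows "stirling_int m 0 = 0"
proof -
  have "(1 - of_int m :: complex) = of_int (1 - m)" by simp
  also have "\<dots> \<in> \<int>\<^sub>\<le>\<^sub>0" using assms by (intro nonpos_Ints_of_int) simp
  finally show ?thesis by (simp add: stirling_int_0 rGamma_eq_zero_iff)
qed

lemma stirling_int_nonpos_0: "stirling_int (- int n) 0 = 1 / fact n"
  by (simp add: stirling_int_0 rGamma_inverse_Gamma Gamma_fact inverse_eq_divide)

text \<open>For m > 0 the value s(m, 0) vanishes, so passing from m to m + 1 multiplies s(m, 1) by
  -m. The start is s(1, 1) = s(0, 0) = 1.\<close>

lemma stirling_int_pos_1:
  assumes "m > 0"
  shows "stirling_int m 1 \<noteq> 0"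
  using assms
proof (induction m rule: int_gr_induct)
  case base
  show ?case using stirling_int_rec[of 0 1] stirling_int_nonpos_0[of 0] by simp
next
  case (step m)
  then show ?case using stirling_int_rec[of "- m" 1] stirling_int_pos_0[of m]
    by (simp add: add.commute)
qed

subsection \<open>The harmonic logarithms\<close>

lemma roman_fact_neq_0 [simp]: "roman_fact n \<noteq> 0"
  by (simp add: roman_fact_def)

lemma roman_neq_0 [simp]: "roman n \<noteq> 0"
  by (simp add: roman_def)

lemma roman_fact_0 [simp]: "roman_fact 0 = 1"
  by (simp add: roman_fact_def)

text \<open>This remains valid across zero: \<open>roman 0 = 1\<close> fits the value 1 of the
  factorial at both 0 and -1.\<close>

lemma roman_fact_rec: "roman_fact n = roman n * roman_fact (n - 1)"
proof -
  consider "n > 0" | "n = 0" | "n < 0" by linarith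
  then show ?thesis
  proof cases
    case 1
    then obtain k where "n = int (Suc k)"
      using zero_less_imp_eq_int by (metis gr0_implies_Suc of_nat_0_less_iff)
    moreover from this have "nat n = Suc k" by simp
    ultimately show ?thesis by (simp add: roman_fact_def roman_def)
  next
    case 2
    then show ?thesis by (simp add: roman_fact_def roman_def)
  next
    case 3
    define k where "k = nat (- n - 1)"
    have n: "n = - int k - 1" using 3 by (simp add: k_def)
    define P :: complex where "P = (-1) powi (n - 1)"
    have "(-1 :: complex) powi (n - 1 - 1) = - P"
      by (simp add: P_def power_int_diff)
    moreover have "nat (- (n - 1) - 1) = Suc k" "nat (- n - 1) = k" by (simp_all add: n)
    ultimately have "roman_fact (n - 1) = - P / fact (Suc k)" "roman_fact n = P / fact k"
      using 3 by (simp_all add: roman_fact_def P_def del: fact_Suc)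
    moreover have "roman n = - of_nat (Suc k)" using 3 by (simp add: roman_def n)
    ultimately show ?thesis by (simp del: of_nat_Suc)
  qed
qed

text \<open>This is the coefficient of the term \<rho> = 0 in a harmonic logarithm. The term is lost
  in negative degree, where s(-n, 0) = 0.\<close>

lemma roman_fact_stirling_0:
  "roman_fact n * stirling_int (- n) 0 = (if n \<ge> 0 then 1 else 0)"
proof (cases "n \<ge> 0")
  case True
  then show ?thesis
    using stirling_int_nonpos_0[of "nat n"] by (simp add: roman_fact_def)
next
  case False
  then show ?thesis by (simp add: stirling_int_pos_0)
qed

text \<open>The exponent \<alpha> - \<rho> determines \<rho>, so a single summand reaches this
  monomial.\<close>

lemma harmonic_log_nth:
  "harmonic_log n \<alpha> n (\<alpha> - Poly_Mapping.map int \<rho>) =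
     roman_fact n * stirling_int (- n) (lk \<rho> 0) * log_weight \<alpha> \<rho>"
  unfolding harmonic_log_def ls_sum_def
  by (subst Sum_any_single[where a = \<rho>])
     (auto simp: ls_scale_def ell_def log_weight_def log_factor_def[abs_def])

lemma harmonic_log_neq_0D:
  assumes "harmonic_log n \<alpha> m \<beta> \<noteq> 0"
  obtains \<rho> where "m = n" "\<beta> = \<alpha> - Poly_Mapping.map int \<rho>"
proof -
  have "\<exists>\<rho>. m = n \<and> \<beta> = \<alpha> - Poly_Mapping.map int \<rho>"
  proof (rule ccontr)
    assume *: "\<not> ?thesis"
    have "harmonic_log n \<alpha> m \<beta> = 0"
      unfolding harmonic_log_def ls_sum_def
      by (rule Sum_any_zero) (use * in \<open>auto simp: ls_scale_def ell_def\<close>)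
    with assms show False by simp
  qed
  with that show ?thesis by blast
qed

lemma harmonic_log_degree: "m \<noteq> n \<Longrightarrow> harmonic_log n \<alpha> m \<beta> = 0"
  using harmonic_log_neq_0D by blast

text \<open>Beyond the supports of \<alpha> and \<beta>, the entry of
  \<open>\<beta> + ones k\<close> at \<open>k\<close> is 1, whereas exponents in a harmonic
  logarithm are at most 0 there. The bound keeps the sums over \<open>k\<close> in the derivative
  finite.\<close>

lemma harmonic_log_ones_vanish:
  obtains N where "\<And>n k. k \<ge> N \<Longrightarrow> harmonic_log n \<alpha> n (\<beta> + ones k) = 0"
proof -
  obtain N1 where N1: "\<And>i. i \<ge> N1 \<Longrightarrow> lk \<alpha> i = 0" using lookup_eventually_zero by blast
  obtain N2 where N2: "\<And>i. i \<ge> N2 \<Longrightarrow> lk \<beta> i = 0" using lookup_eventually_zero by blast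
  show ?thesis
  proof (rule that[of "max N1 N2"], rule ccontr)
    fix n k assume k: "k \<ge> max N1 N2" and "harmonic_log n \<alpha> n (\<beta> + ones k) \<noteq> 0"
    then obtain \<rho> where "\<beta> + ones k = \<alpha> - Poly_Mapping.map int \<rho>"
      by (elim harmonic_log_neq_0D)
    then have "lk (\<beta> + ones k) k = lk (\<alpha> - Poly_Mapping.map int \<rho>) k" by simp
    then show False using N1[of k] N2[of k] k by (simp add: lookup_add lookup_minus)
  qed
qed

lemma log_comb_nth: "log_comb \<alpha> c m \<beta> = c m * harmonic_log m \<alpha> m \<beta>"
  unfolding log_comb_def ls_sum_def
  by (subst Sum_any_single[where a = m]) (auto simp: ls_scale_def harmonic_log_degree)

subsection \<open>The derivative\<close>

lemma D_ell_nth: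
  "D_ell n \<gamma> m \<beta> = (if n = m + 1 then (if \<gamma> = \<beta> then of_int n else 0) +
     Sum_any (\<lambda>k. if \<gamma> = \<beta> + ones k then of_int (lk \<gamma> k) else 0) else 0)"
proof -
  have "(m = n - 1 \<and> \<beta> = \<gamma> - ones k) \<longleftrightarrow> n = m + 1 \<and> \<gamma> = \<beta> + ones k" for k
    by (auto simp: algebra_simps)
  then show ?thesis
    by (auto simp: D_ell_def ls_add_def ls_scale_def ls_sum_def ell_def if_distrib[of "(*) _"]
        simp flip: ones_def cong: if_cong)
qed

text \<open>Two kinds of monomials contribute: exponent \<beta> through the power of x, and
  \<open>\<beta> + ones k\<close> through the logarithm of index \<open>k\<close>, whose exponent
  \<open>lk \<beta> k + 1\<close> becomes the factor. The hypothesis leaves finitely many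
  contributions, so \<open>Sum_any\<close> does not fall back to 0.\<close>

lemma D_nth:
  assumes N: "\<And>k. k \<ge> N \<Longrightarrow> u (m + 1) (\<beta> + ones k) = 0"
  shows "D u m \<beta> = of_int (m + 1) * u (m + 1) \<beta> +
    Sum_any (\<lambda>k. of_int (lk \<beta> k + 1) * u (m + 1) (\<beta> + ones k))"
proof -
  let ?f = "\<lambda>(n, \<gamma>). u n \<gamma> * D_ell n \<gamma> m \<beta>"
  let ?g = "\<lambda>k. (m + 1, \<beta> + ones k)"
  have self: "D_ell (m + 1) \<beta> m \<beta> = of_int (m + 1)"
  proof -
    have "\<beta> \<noteq> \<beta> + ones k" for k :: nat by simp
    then show ?thesis by (simp add: D_ell_nth)
  qed
  have ones: "D_ell (m + 1) (\<beta> + ones k) m \<beta> = of_int (lk \<beta> k + 1)" for k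
    by (simp add: D_ell_nth Sum_any_single[where a = k] lookup_add)
  have "D u m \<beta> = Sum_any ?f"
    by (simp add: D_def ls_sum_def ls_scale_def case_prod_beta)
  also have "\<dots> = sum ?f (insert (m + 1, \<beta>) (?g ` {..<N}))"
  proof (rule Sum_any.expand_superset)
    show "{a. ?f a \<noteq> 0} \<subseteq> insert (m + 1, \<beta>) (?g ` {..<N})"
    proof
      fix a assume "a \<in> {a. ?f a \<noteq> 0}"
      then obtain n \<gamma> where a: "a = (n, \<gamma>)" "u n \<gamma> \<noteq> 0" "D_ell n \<gamma> m \<beta> \<noteq> 0"
        by (cases a) auto
      show "a \<in> insert (m + 1, \<beta>) (?g ` {..<N})"
      proof (cases "\<exists>k. \<gamma> = \<beta> + ones k")
        case True
        then obtain k where k: "\<gamma> = \<beta> + ones k" by blast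
        have "n = m + 1" using a(3) by (simp add: D_ell_nth split: if_splits)
        then have "k < N" using N[of k] a(2) k by (cases "k < N") auto
        then show ?thesis using \<open>n = m + 1\<close> k a(1) by blast
      next
        case False
        then show ?thesis using a by (simp add: D_ell_nth split: if_splits)
      qed
    qed
  qed simp
  also have "\<dots> = ?f (m + 1, \<beta>) + sum ?f (?g ` {..<N})"
    by (rule sum.insert) auto
  also have "sum ?f (?g ` {..<N}) = (\<Sum>k<N. ?f (?g k))"
    by (subst sum.reindex) (auto simp: inj_on_def)
  also have "\<dots> = (\<Sum>k<N. of_int (lk \<beta> k + 1) * u (m + 1) (\<beta> + ones k))"
    unfolding prod.case ones by (simp only: mult.commute)
  also have "\<dots> = Sum_any (\<lambda>k. of_int (lk \<beta> k + 1) * u (m + 1) (\<beta> + ones k))"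
    by (rule Sum_any.expand_superset[symmetric]) (use N not_le in auto)
  finally show ?thesis by (simp add: self del: of_int_add)
qed

text \<open>This is D \<lambda>_n = \<open>roman n\<close> \<lambda>_(n-1) read off at one monomial.
  For \<beta> = \<alpha> - \<rho> with \<rho> a partition, the weights in the sum telescope to the
  weight of \<rho>, and the Stirling recurrence merges the two terms.\<close>

lemma harmonic_log_recurrence:
  "of_int n * harmonic_log n \<alpha> n \<beta> +
     Sum_any (\<lambda>k. of_int (lk \<beta> k + 1) * harmonic_log n \<alpha> n (\<beta> + ones k)) =
   roman n * harmonic_log (n - 1) \<alpha> (n - 1) \<beta>"
proof (cases "\<exists>\<rho>. \<beta> = \<alpha> - Poly_Mapping.map int \<rho>")
  case False
  have "harmonic_log m \<alpha> m \<beta> = 0" for m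
    using False harmonic_log_neq_0D by metis
  moreover have "harmonic_log n \<alpha> n (\<beta> + ones k) = 0" for k
  proof (rule ccontr)
    assume "harmonic_log n \<alpha> n (\<beta> + ones k) \<noteq> 0"
    then obtain \<rho> where \<rho>: "\<beta> + ones k = \<alpha> - Poly_Mapping.map int \<rho>"
      by (elim harmonic_log_neq_0D)
    have "\<beta> = \<alpha> - Poly_Mapping.map int (\<rho> + ones k)"
    proof (rule poly_mapping_eqI)
      fix i
      have "lk (\<beta> + ones k) i = lk (\<alpha> - Poly_Mapping.map int \<rho>) i" using \<rho> by simp
      then show "lk \<beta> i = lk (\<alpha> - Poly_Mapping.map int (\<rho> + ones k)) i"
        by (auto simp: lookup_add lookup_minus split: if_splits)
    qed
    with False show False by blast
  qed
  ultimately show ?thesis by simp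
next
  case True
  then obtain \<rho> where \<beta>: "\<beta> = \<alpha> - Poly_Mapping.map int \<rho>" by blast
  \<comment> \<open>A term at \<open>\<beta> + ones k\<close> comes from \<rho> with one removed
    from each of its first \<open>k + 1\<close> entries. Subtraction of naturals is truncated, so
    positivity of these entries is recorded too.\<close>
  have shift: "\<rho>' = \<rho> - ones k \<and> (\<forall>i\<le>k. lk \<rho> i > 0)"
    if "\<beta> + ones k = \<alpha> - Poly_Mapping.map int \<rho>'" for k \<rho>'
  proof -
    have "lk (\<beta> + ones k) i = lk (\<alpha> - Poly_Mapping.map int \<rho>') i" for i using that by simp
    then have *: "int (lk \<rho>' i) = int (lk \<rho> i) - (if i \<le> k then 1 else 0)" for i
      unfolding \<beta> by (simp add: lookup_add lookup_minus algebra_simps split: if_splits)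
    have "\<rho>' = \<rho> - ones k"
    proof (rule poly_mapping_eqI)
      fix i show "lk \<rho>' i = lk (\<rho> - ones k) i"
        using *[of i] by (auto simp: lookup_minus split: if_splits)
    qed
    moreover have "lk \<rho> i > 0" if "i \<le> k" for i using *[of i] that by simp
    ultimately show ?thesis by blast
  qed
  have unshift: "\<beta> + ones k = \<alpha> - Poly_Mapping.map int (\<rho> - ones k)" if "\<forall>i\<le>k. lk \<rho> i > 0" for k
  proof (rule poly_mapping_eqI)
    fix i show "lk (\<beta> + ones k) i = lk (\<alpha> - Poly_Mapping.map int (\<rho> - ones k)) i"
      using that unfolding \<beta> by (auto simp: lookup_add lookup_minus Suc_le_eq)
  qed
  define s where "s = (\<lambda>j. roman_fact n * stirling_int (- n) j)"
  have rhs: "roman n * harmonic_log (n - 1) \<alpha> (n - 1) \<beta> =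
      (of_int n * s (lk \<rho> 0) + (if lk \<rho> 0 = 0 then 0 else s (lk \<rho> 0 - 1))) * log_weight \<alpha> \<rho>"
    using stirling_int_rec[of n "lk \<rho> 0"] roman_fact_rec[of n]
    unfolding \<beta> harmonic_log_nth by (simp add: s_def algebra_simps)
  show ?thesis
  proof (cases "antimono (lk \<rho>)")
    case False
    \<comment> \<open>Adding \<open>ones k\<close> back to a weakly decreasing sequence keeps it
      weakly decreasing, so \<open>\<rho> - ones k\<close> cannot be a partition either.\<close>
    have "harmonic_log n \<alpha> n (\<beta> + ones k) = 0" for k
    proof (rule ccontr)
      assume nz: "harmonic_log n \<alpha> n (\<beta> + ones k) \<noteq> 0"
      then obtain \<rho>' where \<rho>': "\<beta> + ones k = \<alpha> - Poly_Mapping.map int \<rho>'"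
        by (elim harmonic_log_neq_0D)
      note shift[OF \<rho>']
      moreover have "antimono (lk \<rho>')"
        using nz unfolding \<rho>' harmonic_log_nth log_weight_def by (auto split: if_splits)
      ultimately have **: "lk (\<rho> - ones k) (Suc i) \<le> lk (\<rho> - ones k) i" "i \<le> k \<Longrightarrow> lk \<rho> i > 0" for i
        unfolding antimono_Suc_iff by auto
      have "antimono (lk \<rho>)"
        unfolding antimono_Suc_iff
      proof
        fix i show "lk \<rho> (Suc i) \<le> lk \<rho> i"
          using **(1)[of i] **(2)[of i] **(2)[of "Suc i"]
          by (auto simp: lookup_minus split: if_splits)
      qed
      with False show False by simp
    qed
    moreover have "log_weight \<alpha> \<rho> = 0" using False by (simp add: log_weight_def)
    ultimately show ?thesis unfolding rhs unfolding \<beta> harmonic_log_nth by simp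
  next
    case True
    obtain K where K: "\<And>i. lk \<rho> i > 0 \<longleftrightarrow> i < K" using partition_length[OF True] by blast
    have zero: "harmonic_log n \<alpha> n (\<beta> + ones k) = 0" if "k \<ge> K" for k
    proof (rule ccontr)
      assume "harmonic_log n \<alpha> n (\<beta> + ones k) \<noteq> 0"
      then obtain \<rho>' where "\<beta> + ones k = \<alpha> - Poly_Mapping.map int \<rho>'"
        by (elim harmonic_log_neq_0D)
      from shift[OF this] show False using K[of k] that by simp
    qed
    have summand: "of_int (lk \<beta> k + 1) * harmonic_log n \<alpha> n (\<beta> + ones k) =
        s (lk \<rho> 0 - 1) * (of_int (lk \<alpha> k - int (lk \<rho> k) + 1) * log_weight \<alpha> (\<rho> - ones k))"
      if "k < K" for k
    proof -
      have "\<forall>i\<le>k. lk \<rho> i > 0" using K that by simp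
      note unshift[OF this]
      moreover have "lk \<beta> k = lk \<alpha> k - int (lk \<rho> k)" by (simp add: \<beta> lookup_minus)
      ultimately show ?thesis by (simp add: harmonic_log_nth s_def lookup_minus)
    qed
    have "Sum_any (\<lambda>k. of_int (lk \<beta> k + 1) * harmonic_log n \<alpha> n (\<beta> + ones k)) =
        (\<Sum>k<K. of_int (lk \<beta> k + 1) * harmonic_log n \<alpha> n (\<beta> + ones k))"
      by (rule Sum_any.expand_superset) (use zero not_le in auto)
    also have "\<dots> = s (lk \<rho> 0 - 1) *
        (\<Sum>k<K. of_int (lk \<alpha> k - int (lk \<rho> k) + 1) * log_weight \<alpha> (\<rho> - ones k))"
      unfolding sum_distrib_left by (intro sum.cong refl summand) simp
    \<comment> \<open>If the first entry is 0, then \<open>K = 0\<close> and the sum is empty;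
      otherwise the weights telescope.\<close>
    also have "\<dots> = (if lk \<rho> 0 = 0 then 0 else s (lk \<rho> 0 - 1)) * log_weight \<alpha> \<rho>"
      using log_weight_telescope[OF True K, of \<alpha>] K[of 0] by (cases "K > 0") auto
    finally show ?thesis
      unfolding rhs by (simp add: \<beta> harmonic_log_nth s_def algebra_simps)
  qed
qed

lemma D_log_comb: "D (log_comb \<alpha> c) = log_comb \<alpha> (\<lambda>m. roman (m + 1) * c (m + 1))"
proof (intro ext)
  fix m \<beta>
  obtain N where N: "\<And>n k. k \<ge> N \<Longrightarrow> harmonic_log n \<alpha> n (\<beta> + ones k) = 0"
    using harmonic_log_ones_vanish[of \<alpha> \<beta>] by blast
  have fin: "finite {k. of_int (lk \<beta> k + 1) * harmonic_log (m + 1) \<alpha> (m + 1) (\<beta> + ones k) \<noteq> 0}"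
    by (rule finite_subset[of _ "{..<N}"]) (use N not_le in auto)
  have "D (log_comb \<alpha> c) m \<beta> =
      of_int (m + 1) * log_comb \<alpha> c (m + 1) \<beta> +
      Sum_any (\<lambda>k. of_int (lk \<beta> k + 1) * log_comb \<alpha> c (m + 1) (\<beta> + ones k))"
    by (rule D_nth[of N]) (simp add: log_comb_nth N)
  also have "\<dots> = c (m + 1) * (of_int (m + 1) * harmonic_log (m + 1) \<alpha> (m + 1) \<beta> +
      Sum_any (\<lambda>k. of_int (lk \<beta> k + 1) * harmonic_log (m + 1) \<alpha> (m + 1) (\<beta> + ones k)))"
    unfolding log_comb_nth distrib_left Sum_any_right_distrib[OF fin] by (simp add: mult_ac)
  also have "\<dots> = c (m + 1) * (roman (m + 1) * harmonic_log m \<alpha> m \<beta>)"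
    unfolding harmonic_log_recurrence by simp
  finally show "D (log_comb \<alpha> c) m \<beta> = log_comb \<alpha> (\<lambda>m. roman (m + 1) * c (m + 1)) m \<beta>"
    by (simp add: log_comb_nth)
qed

section \<open>Order zero and nonvanishing of the harmonic logarithms\<close>

lemma harmonic_log_zero_exponent:
  "harmonic_log n 0 m \<beta> = (if m = n \<and> \<beta> = 0 \<and> n \<ge> 0 then 1 else 0)"
proof (cases "m = n \<and> (\<exists>\<rho>. \<beta> = 0 - Poly_Mapping.map int \<rho>)")
  case False
  have "0 - Poly_Mapping.map int 0 = 0" by (rule poly_mapping_eqI) (simp add: lookup_minus)
  with False have "\<not> (m = n \<and> \<beta> = 0 \<and> n \<ge> 0)" by metis
  moreover have "harmonic_log n 0 m \<beta> = 0" using False harmonic_log_neq_0D by metis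
  ultimately show ?thesis by simp
next
  case True
  then obtain \<rho> where \<rho>: "\<beta> = 0 - Poly_Mapping.map int \<rho>" and [simp]: "m = n" by blast
  have "\<beta> = 0 \<longleftrightarrow> \<rho> = 0"
    unfolding \<rho> by (simp add: poly_mapping_eq_iff fun_eq_iff lookup_minus)
  then show ?thesis
    using roman_fact_stirling_0[of n] log_weight_zero_exponent[of \<rho>] harmonic_log_nth[of n 0 0]
    by (cases "\<rho> = 0") (simp_all add: \<rho> harmonic_log_nth del: diff_0)
qed

lemma harmonic_log_0_eq_ell: "n \<ge> 0 \<Longrightarrow> harmonic_log n 0 = ell n 0"
  by (intro ext) (simp add: harmonic_log_zero_exponent ell_def)

text \<open>For n \<ge> 0 the term \<rho> = 0 survives. In negative degree \<open>ones k\<close>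
  with \<open>lk \<alpha> k \<noteq> 0\<close> takes its place. Coefficients in
  \<open>log_comb\<close> are therefore unique in these degrees.\<close>

lemma harmonic_log_neq_0:
  assumes "n \<ge> 0 \<or> \<alpha> \<noteq> 0"
  shows "\<exists>\<beta>. harmonic_log n \<alpha> n \<beta> \<noteq> 0"
proof (cases "n \<ge> 0")
  case True
  then show ?thesis
    using harmonic_log_nth[of n \<alpha> 0] roman_fact_stirling_0[of n]
    by (intro exI[of _ "\<alpha> - Poly_Mapping.map int 0"]) simp
next
  case False
  with assms have "\<alpha> \<noteq> 0" by blast
  then obtain k where k: "lk \<alpha> k \<noteq> 0" by (metis lookup_zero poly_mapping_eqI)
  have "harmonic_log n \<alpha> n (\<alpha> - Poly_Mapping.map int (ones k)) \<noteq> 0"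
    using False log_weight_ones_neq_0[OF k] stirling_int_pos_1[of "- n"]
    by (simp add: harmonic_log_nth)
  then show ?thesis by blast
qed

subsection \<open>Laurent series\<close>

text \<open>The exponent is negated because degrees are bounded above, whereas Laurent series are
  bounded below.\<close>

definition log_laurent :: "expo \<Rightarrow> complex fls \<Rightarrow> log_series" where
  "log_laurent \<alpha> F = log_comb \<alpha> (\<lambda>m. F $$ (- m) / roman_fact m)"

text \<open>The convolution is reindexed so that it runs over the exponents of \<open>h\<close>, as
  in \<open>fps_op\<close>.\<close>

lemma fls_nth_fps_times:
  fixes h :: "'a::comm_semiring_1 fps"
  shows "(fps_to_fls h * F) $$ n = Sum_any (\<lambda>k. fps_nth h k * F $$ (n - int k))"
proof -
  let ?H = "fps_to_fls h"
  define I where "I = {fls_subdegree F..n - fls_subdegree ?H}"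
  have pos: "fls_subdegree ?H \<ge> 0" by (rule fls_subdegree_fls_to_fps_gt0)
  have inj: "inj_on (\<lambda>i. nat (n - i)) I"
    using pos by (auto simp: inj_on_def I_def)
  have "Sum_any (\<lambda>k. fps_nth h k * F $$ (n - int k)) =
      (\<Sum>k\<in>(\<lambda>i. nat (n - i)) ` I. fps_nth h k * F $$ (n - int k))"
  proof (rule Sum_any.expand_superset)
    show "{k. fps_nth h k * F $$ (n - int k) \<noteq> 0} \<subseteq> (\<lambda>i. nat (n - i)) ` I"
    proof
      fix k assume "k \<in> {k. fps_nth h k * F $$ (n - int k) \<noteq> 0}"
      then have "?H $$ int k \<noteq> 0" "F $$ (n - int k) \<noteq> 0" by auto
      then have "n - int k \<in> I"
        using fls_subdegree_leI[of ?H "int k"] fls_subdegree_leI[of F "n - int k"]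
        by (simp add: I_def)
      then show "k \<in> (\<lambda>i. nat (n - i)) ` I" by (intro image_eqI[of _ _ "n - int k"]) auto
    qed
  qed (simp add: I_def)
  also have "\<dots> = (\<Sum>i\<in>I. F $$ i * ?H $$ (n - i))"
    unfolding sum.reindex[OF inj] using pos by (intro sum.cong) (auto simp: I_def mult.commute)
  also have "\<dots> = (F * ?H) $$ n"
    by (simp add: fls_times_nth(2) I_def)
  finally show ?thesis by (simp add: mult.commute)
qed

lemma D_log_laurent: "D (log_laurent \<alpha> F) = log_laurent \<alpha> (fls_X * F)"
proof -
  have "roman (m + 1) * (F $$ (- (m + 1)) / roman_fact (m + 1)) = (fls_X * F) $$ (- m) / roman_fact m"
    for m
    using roman_fact_rec[of "m + 1"] by (simp add: fls_X_times_conv_shift)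
  then show ?thesis by (simp add: log_laurent_def D_log_comb)
qed

lemma D_power_log_laurent: "(D ^^ k) (log_laurent \<alpha> F) = log_laurent \<alpha> (fls_X ^ k * F)"
  by (induction k) (simp_all add: D_log_laurent mult.assoc)

text \<open>As D acts by X, h(D) acts by h(X). Only finitely many powers of D reach a given
  coefficient because \<open>F\<close> is bounded below.\<close>

lemma fps_op_log_laurent: "fps_op h (log_laurent \<alpha> F) = log_laurent \<alpha> (fps_to_fls h * F)"
proof (intro ext)
  fix m \<beta>
  have fin: "finite {k. fps_nth h k * F $$ (- m - int k) \<noteq> 0}"
  proof (rule finite_subset)
    show "{k. fps_nth h k * F $$ (- m - int k) \<noteq> 0} \<subseteq> {..nat (- m - fls_subdegree F)}"
      using fls_subdegree_leI[of F] by force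
  qed simp
  have "fps_op h (log_laurent \<alpha> F) m \<beta> =
      Sum_any (\<lambda>k. fps_nth h k * F $$ (- m - int k) * (harmonic_log m \<alpha> m \<beta> / roman_fact m))"
    unfolding fps_op_def D_power_log_laurent ls_sum_def ls_scale_def
    by (simp add: log_laurent_def log_comb_nth fls_X_power_times_conv_shift mult_ac)
  also have "\<dots> = log_laurent \<alpha> (fps_to_fls h * F) m \<beta>"
    unfolding Sum_any_left_distrib[OF fin, symmetric]
    by (simp add: log_laurent_def log_comb_nth fls_nth_fps_times)
  finally show "fps_op h (log_laurent \<alpha> F) m \<beta> = log_laurent \<alpha> (fps_to_fls h * F) m \<beta>" .
qed

lemma log_comb_eq_log_laurent:
  assumes "bdd_degree c"
  obtains F where "log_comb \<alpha> c = log_laurent \<alpha> F" "\<And>m. F $$ (- m) = roman_fact m * c m"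
proof -
  obtain N where N: "\<And>n. n > N \<Longrightarrow> c n = 0" using assms by (auto simp: bdd_degree_def)
  define F where "F = Abs_fls (\<lambda>k. roman_fact (- k) * c (- k))"
  have F: "F $$ k = roman_fact (- k) * c (- k)" for k
    unfolding F_def by (subst nth_Abs_fls_lower_bound[of "- N"]) (use N in auto)
  show ?thesis
    by (rule that[of F]) (simp_all add: log_laurent_def F)
qed

lemma bdd_degree_log_laurent: "bdd_degree (\<lambda>m. F $$ (- m) / roman_fact m)"
  unfolding bdd_degree_def by (rule exI[of _ "- fls_subdegree F"]) simp

lemma log_comb_inj:
  assumes "log_comb \<alpha> c = log_comb \<alpha> c'" "n \<ge> 0 \<or> \<alpha> \<noteq> 0"
  shows "c n = c' n"
proof -
  obtain \<beta> where \<beta>: "harmonic_log n \<alpha> n \<beta> \<noteq> 0" using harmonic_log_neq_0[OF assms(2)] by (rule exE)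
  have "c n * harmonic_log n \<alpha> n \<beta> = c' n * harmonic_log n \<alpha> n \<beta>"
    using fun_cong[OF fun_cong[OF assms(1)], of n \<beta>] by (simp only: log_comb_nth)
  then show ?thesis by (rule mult_right_cancel[OF \<beta>, THEN iffD1])
qed

lemma log_comb_eqI:
  assumes "\<And>n. n \<ge> 0 \<or> \<alpha> \<noteq> 0 \<Longrightarrow> c n = c' n"
  shows "log_comb \<alpha> c = log_comb \<alpha> c'"
proof (intro ext)
  fix m \<beta>
  show "log_comb \<alpha> c m \<beta> = log_comb \<alpha> c' m \<beta>"
    using assms[of m] by (cases "m \<ge> 0 \<or> \<alpha> \<noteq> 0") (auto simp: log_comb_nth harmonic_log_zero_exponent)
qed

text \<open>The condition on \<open>k\<close> expresses congruence modulo X C[[X]] for \<alpha> = 0,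
  where the harmonic logarithms of negative degree vanish.\<close>

lemma log_laurent_eq_iff:
  "log_laurent \<alpha> F = log_laurent \<alpha> G \<longleftrightarrow> (\<forall>k. k \<le> 0 \<or> \<alpha> \<noteq> 0 \<longrightarrow> F $$ k = G $$ k)"
proof
  assume eq: "log_laurent \<alpha> F = log_laurent \<alpha> G"
  show "\<forall>k. k \<le> 0 \<or> \<alpha> \<noteq> 0 \<longrightarrow> F $$ k = G $$ k"
  proof (intro allI impI)
    fix k :: int assume "k \<le> 0 \<or> \<alpha> \<noteq> 0"
    then show "F $$ k = G $$ k"
      using log_comb_inj[OF eq[unfolded log_laurent_def], of "- k"] by simp
  qed
next
  assume *: "\<forall>k. k \<le> 0 \<or> \<alpha> \<noteq> 0 \<longrightarrow> F $$ k = G $$ k"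
  have "F $$ (- n) / roman_fact n = G $$ (- n) / roman_fact n" if "n \<ge> 0 \<or> \<alpha> \<noteq> 0" for n
    using *[rule_format, of "- n"] that by simp
  then show "log_laurent \<alpha> F = log_laurent \<alpha> G"
    unfolding log_laurent_def by (rule log_comb_eqI)
qed

lemma harmonic_log_eq_log_laurent:
  "harmonic_log n \<alpha> = log_laurent \<alpha> (fls_const (roman_fact n) * fls_X powi (- n))"
proof (intro ext)
  fix m \<beta>
  show "harmonic_log n \<alpha> m \<beta> = log_laurent \<alpha> (fls_const (roman_fact n) * fls_X powi (- n)) m \<beta>"
    by (cases "m = n") (simp_all add: log_laurent_def log_comb_nth harmonic_log_degree)
qed

lemma ls_scale_log_laurent: "ls_scale a (log_laurent \<alpha> F) = log_laurent \<alpha> (fls_const a * F)"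
  by (intro ext) (simp add: ls_scale_def log_laurent_def log_comb_nth)

section \<open>Augmentation and Roman shift on Laurent series\<close>

lemma augmentation_log_laurent: "augmentation \<alpha> (log_laurent \<alpha> F) = F $$ 0"
  unfolding augmentation_def
proof (rule the_equality)
  show "\<exists>c. bdd_degree c \<and> log_laurent \<alpha> F = log_comb \<alpha> c \<and> F $$ 0 = c 0"
    by (intro exI[of _ "\<lambda>m. F $$ (- m) / roman_fact m"])
       (simp add: bdd_degree_log_laurent log_laurent_def)
next
  fix z assume "\<exists>c. bdd_degree c \<and> log_laurent \<alpha> F = log_comb \<alpha> c \<and> z = c 0"
  then obtain c where "log_comb \<alpha> (\<lambda>m. F $$ (- m) / roman_fact m) = log_comb \<alpha> c" "z = c 0"
    unfolding log_laurent_def by blast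
  from log_comb_inj[OF this(1), of 0] this(2) show "z = F $$ 0" by simp
qed

text \<open>The image of X^-n is (n + 1) X^(-n-1). For n \<noteq> -1 the factor n + 1 turns the
  Roman factorial of n into that of n + 1; for n = -1 a constant is differentiated, just as the
  shift kills \<lambda>_(-1).\<close>

definition laurent_shift :: "complex fls \<Rightarrow> complex fls" where
  "laurent_shift F = - (fls_X * fls_deriv (fls_X_inv * F))"

lemma laurent_shift_nth: "laurent_shift F $$ k = - of_int k * F $$ (k + 1)"
  by (simp add: laurent_shift_def fls_X_times_conv_shift fls_X_inv_times_conv_shift)

lemma roman_shift_sum:
  "ls_sum (\<lambda>n. ls_scale (c n) (if n = -1 then (\<lambda>_ _. 0) else harmonic_log (n + 1) \<alpha>)) =
     log_comb \<alpha> (\<lambda>m. if m = 0 then 0 else c (m - 1))"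
proof (intro ext)
  fix m \<beta>
  show "ls_sum (\<lambda>n. ls_scale (c n) (if n = -1 then (\<lambda>_ _. 0) else harmonic_log (n + 1) \<alpha>)) m \<beta> =
      log_comb \<alpha> (\<lambda>m. if m = 0 then 0 else c (m - 1)) m \<beta>"
    unfolding ls_sum_def
    by (subst Sum_any_single[where a = "m - 1"])
       (auto simp: ls_scale_def log_comb_nth harmonic_log_degree)
qed

lemma log_laurent_shift:
  "log_laurent \<alpha> (laurent_shift F) =
     log_comb \<alpha> (\<lambda>m. if m = 0 then 0 else F $$ (- (m - 1)) / roman_fact (m - 1))"
proof -
  have "laurent_shift F $$ (- m) / roman_fact m =
      (if m = 0 then 0 else F $$ (- (m - 1)) / roman_fact (m - 1))" for m
    by (simp add: laurent_shift_nth roman_fact_rec[of m] roman_def)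
  then show ?thesis unfolding log_laurent_def by simp
qed

lemma roman_shift_log_laurent:
  "roman_shift \<alpha> (log_laurent \<alpha> F) = log_laurent \<alpha> (laurent_shift F)"
  unfolding roman_shift_def roman_shift_sum
proof (rule the_equality)
  show "\<exists>c. bdd_degree c \<and> log_laurent \<alpha> F = log_comb \<alpha> c \<and>
      log_laurent \<alpha> (laurent_shift F) = log_comb \<alpha> (\<lambda>m. if m = 0 then 0 else c (m - 1))"
    unfolding log_laurent_shift
    by (intro exI[of _ "\<lambda>m. F $$ (- m) / roman_fact m"])
       (simp add: bdd_degree_log_laurent log_laurent_def)
next
  fix v assume "\<exists>c. bdd_degree c \<and> log_laurent \<alpha> F = log_comb \<alpha> c \<and>
      v = log_comb \<alpha> (\<lambda>m. if m = 0 then 0 else c (m - 1))"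
  then obtain c where eq: "log_comb \<alpha> (\<lambda>m. F $$ (- m) / roman_fact m) = log_comb \<alpha> c"
    and v: "v = log_comb \<alpha> (\<lambda>m. if m = 0 then 0 else c (m - 1))"
    unfolding log_laurent_def by blast
  show "v = log_laurent \<alpha> (laurent_shift F)"
    unfolding v log_laurent_shift
  proof (rule log_comb_eqI)
    \<comment> \<open>At order 0, uniqueness covers the coefficient at n - 1 only for n \<ge> 1.
      This suffices, since both sides are 0 at n = 0.\<close>
    fix n :: int assume "n \<ge> 0 \<or> \<alpha> \<noteq> 0"
    then have "F $$ (- (n - 1)) / roman_fact (n - 1) = c (n - 1)" if "n \<noteq> 0"
      using log_comb_inj[OF eq, of "n - 1"] that by auto
    then show "(if n = 0 then 0 else c (n - 1)) =
        (if n = 0 then 0 else F $$ (- (n - 1)) / roman_fact (n - 1))"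
      by auto
  qed
qed

text \<open>At order 0 the harmonic logarithms are the powers x^n with n \<ge> 0. In degree 0 both
  sides vanish, because x^-1 does not occur.\<close>

lemma x_mult_log_laurent: "x_mult (log_laurent 0 F) = log_laurent 0 (laurent_shift F)"
  unfolding log_laurent_shift
  by (intro ext) (simp add: x_mult_def log_laurent_def log_comb_nth harmonic_log_zero_exponent)

subsection \<open>The associated sequence\<close>

lemma fls_deriv_power_int:
  fixes F :: "'a :: field fls"
  assumes "F \<noteq> 0"
  shows "fls_deriv (F powi n) = of_int n * F powi (n - 1) * fls_deriv F"
proof -
  have nonneg: "fls_deriv (F powi int k) = of_nat k * F powi (int k - 1) * fls_deriv F" for k
  proof (cases k)
    case (Suc j)
    have "int k - 1 = int j" using Suc by simp
    then show ?thesis unfolding Suc by (simp only: power_int_of_nat fls_deriv_power diff_Suc_1)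
  qed simp
  show ?thesis
  proof (cases "n \<ge> 0")
    case True
    then show ?thesis using nonneg[of "nat n"] by simp
  next
    case False
    define k where "k = nat (- n)"
    have n: "n = - int k" using False by (simp add: k_def)
    \<comment> \<open>For negative exponents, differentiate F^k F^-k = 1 and solve for the second
      derivative.\<close>
    have "0 = fls_deriv (F powi int k * F powi n)"
      using assms by (simp add: n power_int_minus)
    also have "\<dots> = F powi int k * fls_deriv (F powi n) +
        of_nat k * F powi (int k - 1) * fls_deriv F * F powi n"
      by (simp only: fls_deriv_mult nonneg)
    finally have "F powi int k * fls_deriv (F powi n) =
        F powi int k * (of_int n * F powi (n - 1) * fls_deriv F)"
      using assms by (simp add: n power_int_diff power_int_minus field_simps eq_neg_iff_add_eq_0)
    then show ?thesis using assms by simp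
  qed
qed

lemma fps_to_fls_power_int:
  fixes g :: "'a :: field fps"
  assumes "fps_nth g 0 \<noteq> 0"
  shows "fps_to_fls (g powi n) = fps_to_fls g powi n"
  using assms by (simp add: power_int_def fps_to_fls_power flip: fls_inverse_fps_to_fls)

text \<open>If some \<open>R n\<close> had order -j < 0, then \<open>R (n - 1)\<close> would have
  order -j + 1, and after j steps a member would have order 0, against \<open>R0\<close>. For
  \<alpha> \<noteq> 0 the recurrence, read backwards, then raises the order of every member beyond
  any bound.\<close>

lemma laurent_recurrence_unique:
  fixes F :: "complex fls" and R :: "int \<Rightarrow> complex fls"
  assumes F: "fls_subdegree F = 1"
    and R0: "\<And>n. R n $$ 0 = 0"
    and rec: "\<And>n k. k \<le> 0 \<or> \<alpha> \<noteq> 0 \<Longrightarrow> (F * R n) $$ k = roman n * R (n - 1) $$ k"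
    and k: "k \<le> 0 \<or> \<alpha> \<noteq> (0 :: expo)"
  shows "R n $$ k = 0"
proof -
  have F0: "F \<noteq> 0" using F by auto
  \<comment> \<open>The zero series is set apart because its \<open>fls_subdegree\<close> is 0 by
    convention.\<close>
  have sub: "fls_subdegree (R n) \<noteq> - int j" if "R n \<noteq> 0" for j n
    using that
  proof (induction j arbitrary: n)
    case 0
    then have "R n $$ fls_subdegree (R n) \<noteq> 0" by simp
    then show ?case using R0[of n] by (metis minus_zero of_nat_0)
  next
    case (Suc j)
    show ?case
    proof
      assume *: "fls_subdegree (R n) = - int (Suc j)"
      then have deg: "fls_subdegree (F * R n) = - int j"
        using F F0 Suc.prems by simp
      have "(F * R n) $$ (- int j) \<noteq> 0"
        using nth_fls_subdegree_nonzero[of "F * R n"] F0 Suc.prems unfolding deg by simp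
      then have nz: "R (n - 1) $$ (- int j) \<noteq> 0" using rec[of "- int j" n] by simp
      then have ne: "R (n - 1) \<noteq> 0" by (metis fls_zero_nth)
      have "R (n - 1) $$ i = 0" if "i < - int j" for i
        using rec[of i n] that deg fls_eq0_below_subdegree[of i "F * R n"] by simp
      with nz have "fls_subdegree (R (n - 1)) = - int j" by (rule fls_subdegree_eqI)
      with Suc.IH[OF ne] show False by blast
    qed
  qed
  have nonpos: "R n $$ i = 0" if "i \<le> 0" for n i
  proof (rule ccontr)
    assume nz: "R n $$ i \<noteq> 0"
    then have "fls_subdegree (R n) \<le> 0" using fls_subdegree_leI that by fastforce
    then have "fls_subdegree (R n) = - int (nat (- fls_subdegree (R n)))" by simp
    then show False using sub[of n] nz by fastforce
  qed
  show ?thesis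
  proof (cases "k \<le> 0")
    case False
    with k have "\<alpha> \<noteq> 0" by blast
    then have eq: "F * R n = fls_const (roman n) * R (n - 1)" for n
      by (intro fls_eqI) (simp add: rec)
    \<comment> \<open>If all members vanish up to exponent \<open>j\<close>, then
      \<open>F * R (n + 1)\<close> vanishes up to \<open>j + 1\<close>, hence so does
      \<open>R n\<close>.\<close>
    have "R n $$ i = 0" if "i \<le> int j" for i j n
      using that
    proof (induction j arbitrary: n i)
      case 0
      then show ?case by (simp add: nonpos)
    next
      case (Suc j)
      show ?case
      proof (cases "R (n + 1) = 0")
        case True
        then show ?thesis using eq[of "n + 1"] by simp
      next
        case False
        then have "fls_subdegree (R (n + 1)) > int j"
          using Suc.IH[of _ "n + 1"] nth_fls_subdegree_nonzero not_le by blast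
        then have "fls_subdegree (F * R (n + 1)) > int (Suc j)" using F F0 False by simp
        then have "(F * R (n + 1)) $$ i = 0" using Suc.prems by simp
        then show ?thesis unfolding eq by simp
      qed
    qed
    then show ?thesis using zero_le_imp_eq_int[of k] False by (metis linear order_refl)
  qed (rule nonpos)
qed

section \<open>The series of the transfer formula and its uniqueness\<close>

definition transfer_series :: "complex fps \<Rightarrow> int \<Rightarrow> complex fls" where
  "transfer_series f n = fls_const (roman_fact n) *
     (fls_X * fps_to_fls (fps_deriv f) * fps_to_fls f powi (- n - 1))"

text \<open>The derivative of f^-n brings the factor -n, and n times the Roman factorial of n - 1 is
  that of n.\<close>

lemma transfer_series_eq_deriv:
  assumes "f \<noteq> 0" "n \<noteq> 0"
  shows "transfer_series f n =
    - (fls_const (roman_fact (n - 1)) * (fls_X * fls_deriv (fps_to_fls f powi (- n))))"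
proof -
  have "fls_const (roman_fact n) = fls_const (roman_fact (n - 1)) * of_int n"
    using assms(2) roman_fact_rec[of n] by (simp add: roman_def fls_of_int mult.commute)
  moreover have "fls_deriv (fps_to_fls f powi (- n)) =
      - (of_int n * fps_to_fls f powi (- n - 1) * fps_to_fls (fps_deriv f))"
    using assms(1) by (simp add: fls_deriv_power_int fls_deriv_fps_to_fls)
  ultimately show ?thesis
    unfolding transfer_series_def by (simp only: mult_ac minus_mult_right minus_minus)
qed

lemma transfer_series_rec:
  assumes "f \<noteq> 0"
  shows "fps_to_fls f * transfer_series f n = fls_const (roman n) * transfer_series f (n - 1)"
proof -
  have "fps_to_fls f powi (- n) = fps_to_fls f * fps_to_fls f powi (- n - 1)"
    using assms power_int_add[of "fps_to_fls f" 1 "- n - 1"] by simp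
  moreover have "fls_const (roman_fact n) = fls_const (roman n) * fls_const (roman_fact (n - 1))"
    by (simp add: roman_fact_rec[of n])
  moreover have "- (n - 1) - 1 = - n" by simp
  ultimately show ?thesis
    unfolding transfer_series_def by (simp only: mult_ac)
qed

text \<open>For n = 0 the series is f'/g, with constant term a_1/a_1 = 1. For n \<noteq> 0 it is a
  multiple of X times a derivative, and a derivative has no residue.\<close>

lemma transfer_series_nth_0:
  assumes "delta_series f"
  shows "transfer_series f n $$ 0 = (if n = 0 then 1 else 0)"
proof -
  have "f \<noteq> 0" using assms by (auto simp: delta_series_def)
  show ?thesis
  proof (cases "n = 0")
    case True
    define g where "g = fps_shift 1 f"
    have f: "f = fps_X * g"
      using assms by (intro fps_ext) (auto simp: g_def delta_series_def)
    have g0: "fps_nth g 0 \<noteq> 0" using assms by (simp add: g_def delta_series_def)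
    have "transfer_series f 0 = fps_to_fls (fps_deriv f * inverse g)"
      using g0 \<open>f \<noteq> 0\<close>
      by (simp add: transfer_series_def f fls_times_fps_to_fls power_int_minus
          fls_inverse_fps_to_fls[symmetric] field_simps del: fps_deriv_mult)
    then show ?thesis using True g0 by (simp add: f)
  next
    case False
    then show ?thesis
      using transfer_series_eq_deriv[OF \<open>f \<noteq> 0\<close> False]
      by (simp add: fls_X_times_conv_shift)
  qed
qed

text \<open>The difference between the series of \<open>p n \<alpha>\<close> and the transfer series
  obeys the same recurrence and has augmentation 0, so \<open>laurent_recurrence_unique\<close>
  applies.\<close>

lemma associated_eq_log_laurent:
  assumes "delta_series f" "associated f p"
  shows "p n \<alpha> = log_laurent \<alpha> (transfer_series f n)"
proof -
  have "\<exists>P. p n \<alpha> = log_laurent \<alpha> P" for n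
  proof -
    obtain c where "\<forall>k>n. c k = 0" "p n \<alpha> = log_comb \<alpha> c"
      using assms(2) unfolding associated_def log_sequence_def by metis
    then show ?thesis
      using log_comb_eq_log_laurent[of c \<alpha>] unfolding bdd_degree_def by metis
  qed
  then obtain P where P: "\<And>n. p n \<alpha> = log_laurent \<alpha> (P n)" by metis
  have f: "f \<noteq> 0" "fls_subdegree (fps_to_fls f) = 1"
    using assms(1) by (auto simp: delta_series_def fls_subdegree_fls_to_fps intro!: subdegreeI)
  let ?R = "\<lambda>n. P n - transfer_series f n"
  have R0: "?R n $$ 0 = 0" for n
  proof -
    have "augmentation \<alpha> (p n \<alpha>) = (if n = 0 then 1 else 0)"
      using assms(2) by (simp add: associated_def)
    then show ?thesis
      unfolding P augmentation_log_laurent by (simp add: transfer_series_nth_0[OF assms(1)])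
  qed
  have rec: "(fps_to_fls f * ?R n) $$ k = roman n * ?R (n - 1) $$ k" if "k \<le> 0 \<or> \<alpha> \<noteq> 0" for n k
  proof -
    have "fps_op f (p n \<alpha>) = ls_scale (roman n) (p (n - 1) \<alpha>)"
      using assms(2) by (simp add: associated_def)
    then have "(fps_to_fls f * P n) $$ k = roman n * P (n - 1) $$ k"
      unfolding P fps_op_log_laurent ls_scale_log_laurent log_laurent_eq_iff fls_mult_const_nth
      using that by blast
    then show ?thesis by (simp add: transfer_series_rec[OF f(1)] right_diff_distrib)
  qed
  show ?thesis
    unfolding P log_laurent_eq_iff
  proof (intro allI impI)
    fix k :: int assume "k \<le> 0 \<or> \<alpha> \<noteq> 0"
    from laurent_recurrence_unique[OF f(2) R0 rec this, of n]
    show "P n $$ k = transfer_series f n $$ k" by simp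
  qed
qed

section \<open>The transfer, shift and recurrence formulas\<close>

lemma transfer_formula:
  assumes "f = fps_X * g" "fps_nth g 0 \<noteq> 0"
  shows "fps_op (fps_deriv f * g powi (- n - 1)) (harmonic_log n \<alpha>) =
    log_laurent \<alpha> (transfer_series f n)"
proof -
  have "fls_X * fps_to_fls f powi (- n - 1) = fps_to_fls g powi (- n - 1) * fls_X powi (- n)"
    unfolding assms(1) fls_times_fps_to_fls power_int_mult_distrib
    using power_int_add[of "fls_X :: complex fls" 1 "- n - 1"] by (simp add: mult_ac)
  moreover have "transfer_series f n = fls_const (roman_fact n) *
      (fps_to_fls (fps_deriv f) * (fls_X * fps_to_fls f powi (- n - 1)))"
    unfolding transfer_series_def by (simp only: mult_ac)
  ultimately show ?thesis
    unfolding harmonic_log_eq_log_laurent fps_op_log_laurent fls_times_fps_to_fls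
      fps_to_fls_power_int[OF assms(2)]
    by (simp only: mult_ac)
qed

text \<open>The factor X cancels the inverse of X inside the shift, leaving the derivative of f^-n.
  The case n = 0 is excluded because a shifted series has coefficient 0 at X^0, while
  \<open>transfer_series f 0\<close> has 1 there for a delta series.\<close>

lemma laurent_shift_power:
  assumes "f \<noteq> 0" "n \<noteq> 0"
  shows "laurent_shift (fls_const (roman_fact (n - 1)) * (fls_X * fps_to_fls f powi (- n))) =
    transfer_series f n"
proof -
  have "fls_X_inv * (fls_X * F) = F" for F :: "complex fls"
    by (simp add: fls_X_times_conv_shift fls_X_inv_times_conv_shift)
  then have *: "fls_X_inv * (fls_const a * (fls_X * F)) = fls_const a * F" for a and F :: "complex fls"
    unfolding mult.left_commute[of fls_X_inv "fls_const a"] by simp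
  show ?thesis
    unfolding laurent_shift_def * transfer_series_eq_deriv[OF assms] by (simp add: mult.left_commute)
qed

lemma shift_formula:
  assumes "f = fps_X * g" "fps_nth g 0 \<noteq> 0"
  shows "fps_op (g powi (- n)) (harmonic_log (n - 1) \<alpha>) =
    log_laurent \<alpha> (fls_const (roman_fact (n - 1)) * (fls_X * fps_to_fls f powi (- n)))"
proof -
  have "fls_X * fps_to_fls f powi (- n) = fps_to_fls g powi (- n) * fls_X powi (- (n - 1))"
    unfolding assms(1) fls_times_fps_to_fls power_int_mult_distrib
    using power_int_add[of "fls_X :: complex fls" 1 "- n"] by (simp add: mult_ac)
  then show ?thesis
    unfolding harmonic_log_eq_log_laurent fps_op_log_laurent fps_to_fls_power_int[OF assms(2)]
    by (simp only: mult_ac)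
qed

text \<open>Dividing by f' cancels it in the transfer series of index n - 1 and leaves the same
  series as in \<open>shift_formula\<close>, so one shift completes both formulas.\<close>

lemma recurrence_formula:
  assumes "delta_series f"
  shows "fps_op (inverse (fps_deriv f)) (log_laurent \<alpha> (transfer_series f (n - 1))) =
    log_laurent \<alpha> (fls_const (roman_fact (n - 1)) * (fls_X * fps_to_fls f powi (- n)))"
proof -
  have f': "fps_nth (fps_deriv f) 0 \<noteq> 0" using assms by (simp add: delta_series_def)
  then have "fps_deriv f \<noteq> 0" by (metis fps_zero_nth)
  let ?F' = "fps_to_fls (fps_deriv f)"
  have "fps_to_fls (inverse (fps_deriv f)) * transfer_series f (n - 1) =
      (inverse ?F' * ?F') * (fls_const (roman_fact (n - 1)) * (fls_X * fps_to_fls f powi (- n)))"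
    using fls_inverse_fps_to_fls[OF subdegree_eq_0[OF f']] by (simp add: transfer_series_def)
  also have "inverse ?F' * ?F' = 1" using \<open>fps_deriv f \<noteq> 0\<close> by simp
  finally show ?thesis by (simp add: fps_op_log_laurent)
qed

theorem theorem16:
  fixes f g :: "complex fps" and p :: "int \<Rightarrow> expo \<Rightarrow> log_series"
  assumes "delta_series f" and "f = fps_X * g" and "associated f p"
  shows
    "(\<forall>\<alpha>.
        (\<forall>n. p n \<alpha> = fps_op (fps_deriv f * g powi (- n - 1)) (harmonic_log n \<alpha>)) \<and>
        (\<forall>n. n \<noteq> 0 \<and> n \<noteq> -1 \<longrightarrow>
           p n \<alpha> = roman_shift \<alpha> (fps_op (g powi (- n)) (harmonic_log (n - 1) \<alpha>))) \<and>
        (\<forall>n. n \<noteq> 0 \<longrightarrow>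
           p n \<alpha> = roman_shift \<alpha> (fps_op (inverse (fps_deriv f)) (p (n - 1) \<alpha>)))) \<and>
     (\<forall>n\<ge>0. p n 0 = fps_op (fps_deriv f * g powi (- n - 1)) (ell n 0)) \<and>
     (\<forall>n\<ge>1. p n 0 = x_mult (fps_op (g powi (- n)) (ell (n - 1) 0))) \<and>
     (\<forall>n\<ge>1. p n 0 = x_mult (fps_op (inverse (fps_deriv f)) (p (n - 1) 0)))"
proof -
  have f0: "f \<noteq> 0" using assms(1) by (auto simp: delta_series_def)
  have g0: "fps_nth g 0 \<noteq> 0" using assms(1,2) by (simp add: delta_series_def)
  note p = associated_eq_log_laurent[OF assms(1,3)]
  have ell: "ell n 0 = harmonic_log n 0" if "n \<ge> 0" for n
    using harmonic_log_0_eq_ell[OF that] by simp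
  \<comment> \<open>Each right-hand side is rewritten to \<open>log_laurent\<close> of
    \<open>transfer_series f n\<close>, which is \<open>p n\<close> by uniqueness.\<close>
  note simps = p ell transfer_formula[OF assms(2) g0] shift_formula[OF assms(2) g0]
    recurrence_formula[OF assms(1)] roman_shift_log_laurent x_mult_log_laurent
    laurent_shift_power[OF f0]
  show ?thesis by (intro conjI allI impI) (simp_all only: simps simp_thms)
qed

end
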